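(* Let $\mathcal{A}, \mathcal{B} \in \mathbb{R}^{m \times n \times p}$ be orthogonally equivalent. Then $\mathcal{A}$ and $\mathcal{B}$ have the same tensor tubal rank and the same set of T-singular values.
   Context: For a third order tensor $\mathcal{A} = (a_{ijk}) \in \mathbb{R}^{m\times n\times p}$, let $A^{(k)} = (a_{ijk})_{i,j} \in \mathbb{R}^{m\times n}$, $k=1,\dots,p$, be its frontal slices. $\mathrm{bcirc}(\mathcal{A}) \in \mathbb{R}^{mp\times np}$ is the block circulant matrix whose $(s,t)$ block is $A^{(r)}$ with $r \in \{1,\dots,p\}$, $r \equiv s-t+1 \pmod p$ (first block column $A^{(1)},A^{(2)},\dots,A^{(p)}$); $\mathrm{bcirc}^{-1}$ is its inverse, defined on block circulant matrices. T-product: for $\mathcal{A}\in\mathbb{R}^{m\times s\times p}$, $\mathcal{B}\in\mathbb{R}^{s\times n\times p}$, $\mathcal{A}*\mathcal{B} := \mathrm{bcirc}^{-1}(\mathrm{bcirc}(\mathcal{A})\,\mathrm{bcirc}(\mathcal{B})) \in \mathbb{R}^{m\times n\times p}$. Transpose: $\mathcal{A}^\top := \mathrm{bcirc}^{-1}(\mathrm{bcirc}(\mathcal{A})^\top)$. Identity tensor: $\mathcal{I}_{nnp} := \mathrm{bcirc}^{-1}(I_{np})$. A tensor $\mathcal{Q}\in\mathbb{R}^{n\times n\times p}$ is orthogonal if $\mathcal{Q}*\mathcal{Q}^\top=\mathcal{Q}^\top*\mathcal{Q}=\mathcal{I}_{nnp}$. Tensors $\mathcal{A},\mathcal{B}\in\mathbb{R}^{m\times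 n\times p}$ are orthogonally equivalent if $\mathcal{A}=\mathcal{Y}*\mathcal{B}*\mathcal{Z}^\top$ for some orthogonal tensors $\mathcal{Y}\in\mathbb{R}^{m\times m\times p}$, $\mathcal{Z}\in\mathbb{R}^{n\times n\times p}$. Tensor tubal rank of $\mathcal{A}\in\mathbb{R}^{m\times n\times p}$: the smallest integer $r \ge 0$ such that $\mathcal{A}=\mathcal{B}*\mathcal{C}$ for some $\mathcal{B}\in\mathbb{R}^{m\times r\times p}$, $\mathcal{C}\in\mathbb{R}^{r\times n\times p}$ (for $r=0$ the product is the zero tensor). Kilmer-Martin mapping: put $\omega=e^{-2\pi\sqrt{-1}/p}$ and $\Delta^{(k)}=\sum_{l=1}^p \omega^{(k-1)(l-1)}A^{(l)}\in\mathbb{C}^{m\times n}$ for $k=1,\dots,p$. Let $\Sigma(1,1,k)\ge\Sigma(2,2,k)\ge\cdots\ge\Sigma(\min\{m,n\},\min\{m,n\},k)\ge 0$ be the singular values of the matrix $\Delta^{(k)}$ in non-increasing order. Then $\mathcal{S}=\mathcal{S}(\mathcal{A})\in\mathbb{R}^{m\times n\times p}$ is the (real) tensor all of whose frontal slices are diagonal, with diagonal entries $\mathcal{S}(i,i,k)=\frac1p\sum_{l=1}^p\bar\omega^{(k-1)(l-1)}\Sigma(i,i,l)$ for $1\le i\le\min\{m,n\}$, $1\le k\le p$. T-singular values: the $i$th largest T-singular value of $\mathcal{A}$ is $\lambda_i:=\sqrt{\sum_{k=1}^p\mathcal{S}(i,i,k)^2}$, $i=1,\dots,\min\{m,n\}$,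 where $\mathcal{S}=\mathcal{S}(\mathcal{A})$. *)

theory Defs
  imports Complex_Main "HOL-Computational_Algebra.Polynomial"
    "Jordan_Normal_Form.Schur_Decomposition"
begin

(* An m x n x p tensor is the list of its p frontal slices.  All indices are 0-based, so that
   slice k is number k + 1 in the usual 1-based numbering. *)
definition tensors :: "nat \<Rightarrow> nat \<Rightarrow> nat \<Rightarrow> real mat list set" where
  "tensors m n p = {A. length A = p \<and> set A \<subseteq> carrier_mat m n}"

(* Entry (i, j) lies in block (s, t) = (i div m, j div n), which is the slice with
   0-based index (s - t) mod p; adding p avoids truncated subtraction. *)
definition bcirc :: "nat \<Rightarrow> nat \<Rightarrow> nat \<Rightarrow> real mat list \<Rightarrow> real mat" where
  "bcirc m n p A = mat (m * p) (n * p)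
     (\<lambda>(i, j). (A ! ((i div m + p - j div n) mod p)) $$ (i mod m, j mod n))"

(* Meaningful on the block circulant matrices, i.e. on bcirc m n p ` tensors m n p; bcirc is
   injective on tensors m n p for p > 0, see bcirc_inj_on. *)
definition bcirc_inv :: "nat \<Rightarrow> nat \<Rightarrow> nat \<Rightarrow> real mat \<Rightarrow> real mat list" where
  "bcirc_inv m n p = inv_into (tensors m n p) (bcirc m n p)"

(* m x s x p times s x n x p *)
definition t_prod :: "nat \<Rightarrow> nat \<Rightarrow> nat \<Rightarrow> nat \<Rightarrow> real mat list \<Rightarrow> real mat list \<Rightarrow> real mat list" where
  "t_prod m s n p A B = bcirc_inv m n p (bcirc m s p A * bcirc s n p B)"

definition t_transpose :: "nat \<Rightarrow> nat \<Rightarrow> nat \<Rightarrow> real mat list \<Rightarrow> real mat list" where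
  "t_transpose m n p A = bcirc_inv n m p (transpose_mat (bcirc m n p A))"

definition t_id :: "nat \<Rightarrow> nat \<Rightarrow> real mat list" where
  "t_id n p = bcirc_inv n n p (1\<^sub>m (n * p))"

definition t_orthogonal :: "nat \<Rightarrow> nat \<Rightarrow> real mat list \<Rightarrow> bool" where
  "t_orthogonal n p Q \<longleftrightarrow> Q \<in> tensors n n p \<and>
     t_prod n n n p Q (t_transpose n n p Q) = t_id n p \<and>
     t_prod n n n p (t_transpose n n p Q) Q = t_id n p"

definition t_orth_equiv :: "nat \<Rightarrow> nat \<Rightarrow> nat \<Rightarrow> real mat list \<Rightarrow> real mat list \<Rightarrow> bool" where
  "t_orth_equiv m n p A B \<longleftrightarrow>
     A \<in> tensors m n p \<and> B \<in> tensors m n p \<and>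
     (\<exists>Y Z. t_orthogonal m p Y \<and> t_orthogonal n p Z \<and>
        A = t_prod m n n p (t_prod m m n p Y B) (t_transpose n n p Z))"

(* For r = 0 the product of the matrices of sizes (m p) x 0 and 0 x (n p) is the zero matrix. *)
definition tubal_rank :: "nat \<Rightarrow> nat \<Rightarrow> nat \<Rightarrow> real mat list \<Rightarrow> nat" where
  "tubal_rank m n p A =
     (LEAST r. \<exists>B \<in> tensors m r p. \<exists>C \<in> tensors r n p. A = t_prod m r n p B C)"

(* The square roots of the eigenvalues of M\<^sup>* M, with algebraic multiplicity, in
   non-increasing order.  There are dim_col M of them; if dim_row M < dim_col M, those beyond the
   first dim_row M vanish and are dropped. *)
definition singular_values :: "complex mat \<Rightarrow> real list" where
  "singular_values M = take (min (dim_row M) (dim_col M))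
     (rev (sorted_list_of_multiset
       (image_mset (\<lambda>z. sqrt (Re z)) (proots (char_poly (mat_adjoint M * M))))))"

definition omega :: "nat \<Rightarrow> complex" where
  "omega p = exp (- (2 * of_real pi * \<i>) / of_nat p)"

definition fourier_slice :: "nat \<Rightarrow> nat \<Rightarrow> nat \<Rightarrow> real mat list \<Rightarrow> nat \<Rightarrow> complex mat" where
  "fourier_slice m n p A k = mat m n
     (\<lambda>(i, j). \<Sum>l<p. omega p ^ (k * l) * complex_of_real ((A ! l) $$ (i, j)))"

definition km_entry :: "nat \<Rightarrow> nat \<Rightarrow> nat \<Rightarrow> real mat list \<Rightarrow> nat \<Rightarrow> nat \<Rightarrow> complex" where
  "km_entry m n p A i k =
     1 / of_nat p * (\<Sum>l<p. cnj (omega p) ^ (k * l) *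
        complex_of_real (singular_values (fourier_slice m n p A l) ! i))"

(* Re only changes the type here: the numbers km_entry m n p A i k are real,
   see km_entry_real. *)
definition km_tensor :: "nat \<Rightarrow> nat \<Rightarrow> nat \<Rightarrow> real mat list \<Rightarrow> real mat list" where
  "km_tensor m n p A = map (\<lambda>k. mat m n
     (\<lambda>(i, j). if i = j then Re (km_entry m n p A i k) else 0)) [0..<p]"

(* The (i + 1)-st largest T-singular value, for i < min m n. *)
definition t_singular_value :: "nat \<Rightarrow> nat \<Rightarrow> nat \<Rightarrow> real mat list \<Rightarrow> nat \<Rightarrow> real" where
  "t_singular_value m n p A i = sqrt (\<Sum>k<p. ((km_tensor m n p A ! k) $$ (i, i))\<^sup>2)"

(* A multiset: the set of T-singular values is counted with multiplicity. *)
definition t_singular_values :: "nat \<Rightarrow> nat \<Rightarrow> nat \<Rightarrow> real mat list \<Rightarrow> real multiset" where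
  "t_singular_values m n p A = image_mset (t_singular_value m n p A) (mset_set {..<min m n})"


lemma bcirc_inj_on:
  assumes "p > 0"
  shows "inj_on (bcirc m n p) (tensors m n p)"
proof (rule inj_onI)
  fix A B assume A: "A \<in> tensors m n p" and B: "B \<in> tensors m n p"
    and eq: "bcirc m n p A = bcirc m n p B"
  show "A = B"
  proof (rule nth_equalityI)
    show "length A = length B" using A B by (simp add: tensors_def)
  next
    fix k assume "k < length A"
    hence k: "k < p" using A by (simp add: tensors_def)
    have dim: "A ! k \<in> carrier_mat m n" "B ! k \<in> carrier_mat m n"
      using A B k by (auto simp: tensors_def)
    show "A ! k = B ! k"
    proof (rule eq_matI)
      fix i j assume "i < dim_row (B ! k)" "j < dim_col (B ! k)"
      hence ij: "i < m" "j < n" using dim by auto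
      have "k * m + i < Suc k * m" using ij by simp
      also have "\<dots> \<le> m * p" using k by (metis Suc_leI mult.commute mult_le_mono2)
      finally have 1: "k * m + i < m * p" .
      have "n \<le> n * p" using assms by simp
      hence 2: "j < n * p" using ij by linarith
      have "bcirc m n p A $$ (k * m + i, j) = bcirc m n p B $$ (k * m + i, j)" using eq by simp
      thus "A ! k $$ (i, j) = B ! k $$ (i, j)"
        using 1 2 ij k by (simp add: bcirc_def)
    qed (use dim in auto)
  qed
qed

lemma singular_values_cnj: "singular_values (map_mat cnj M) = singular_values M"
proof -
  have "mat_adjoint (map_mat cnj M) * map_mat cnj M = transpose_mat (mat_adjoint M * M)"
    by (rule eq_matI)
      (auto simp: mat_adjoint_def mat_of_rows_def scalar_prod_def intro!: sum.cong)
  moreover have "mat_adjoint M * M \<in> carrier_mat (dim_col M) (dim_col M)"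
    by (auto simp: mat_adjoint_def mat_of_rows_def)
  ultimately show ?thesis
    unfolding singular_values_def by (simp add: char_poly_transpose_mat)
qed

lemma omega_cis: "omega p = cis (- (2 * pi / real p))"
  by (simp add: omega_def cis_conv_exp field_simps)

lemma omega_power_self: "p > 0 \<Longrightarrow> omega p ^ p = 1"
  by (simp add: omega_cis Complex.DeMoivre complex_eq_iff)

lemma cnj_omega: "cnj (omega p) = inverse (omega p)"
  by (simp add: omega_cis cis_cnj)

lemma cnj_omega_power:
  assumes "p > 0" "l < p"
  shows "cnj (omega p) ^ (k * l) = omega p ^ (k * ((p - l) mod p))"
proof (cases "l = 0")
  case False
  have "omega p ^ (k * (p - l)) * omega p ^ (k * l) = omega p ^ (p * k)"
    using assms by (simp flip: power_add add: algebra_simps)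
  also have "\<dots> = 1" using assms by (simp add: power_mult omega_power_self)
  finally have "omega p ^ (k * (p - l)) = inverse (omega p ^ (k * l))"
    by (metis inverse_unique mult.commute)
  thus ?thesis using False assms by (simp add: cnj_omega power_inverse)
qed (use assms in simp)

lemma km_entry_real:
  assumes "p > 0"
  shows "km_entry m n p A i k \<in> \<real>"
proof -
  define h where "h = (\<lambda>l. (p - l) mod p)"
  have h: "h l < p" "h (h l) = l" if "l < p" for l
    using that by (cases "l = 0"; simp add: h_def)+
  have om: "cnj (omega p) ^ (q * l) = omega p ^ (q * h l)"
    "omega p ^ (q * l) = cnj (omega p) ^ (q * h l)" if "l < p" for l q
    using cnj_omega_power[OF assms that, of q] cnj_omega_power[OF assms h(1)[OF that], of q]
      h[OF that] by (simp_all add: h_def)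
  have "fourier_slice m n p A (h l) = map_mat cnj (fourier_slice m n p A l)" if "l < p" for l
    by (rule eq_matI)
      (use that om(1)[of l] in \<open>auto simp: fourier_slice_def mult.commute[of l]
        mult.commute[of "h l"] intro!: sum.cong\<close>)
  hence sv: "singular_values (fourier_slice m n p A (h l)) =
      singular_values (fourier_slice m n p A l)" if "l < p" for l
    using that by (simp add: singular_values_cnj)
  have "(\<Sum>l<p. omega p ^ (k * l) * complex_of_real (singular_values (fourier_slice m n p A l) ! i)) =
      (\<Sum>l<p. cnj (omega p) ^ (k * l) * complex_of_real (singular_values (fourier_slice m n p A l) ! i))"
    by (rule sum.reindex_bij_witness[of _ h h]) (use h sv om in auto)
  hence "cnj (km_entry m n p A i k) = km_entry m n p A i k"
    by (simp add: km_entry_def)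
  thus ?thesis by (simp add: Reals_cnj_iff)
qed

end

theory Submission
  imports Defs
begin

text \<open>
  Two facts about the T-product carry the proof.

  First, it makes tensors a category: block circulant matrices are closed under multiplication and
  transposition, so the map \<open>bcirc\<close> turns \<open>t_prod\<close>, \<open>t_transpose\<close> and \<open>t_id\<close> into the matrix
  operations (\<open>bcirc_t_prod\<close>, \<open>bcirc_t_transpose\<close>, \<open>bcirc_t_id\<close>), and \<open>t_prod\<close> is associative.  If
  \<open>A = Y * B * Z\<^sup>T\<close>, then a factorization \<open>B = C * D\<close> gives \<open>A = (Y * C) * (D * Z\<^sup>T)\<close> through the
  same inner dimension, and \<open>B = Y\<^sup>T * A * Z\<close> gives the converse.  Hence the tubal ranks agree.

  Second, the Fourier transform along the third dimension block diagonalizes all block circulant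
  matrices simultaneously: for each frequency \<open>k\<close>, the map \<open>A \<mapsto> fourier_slice A k\<close> sends T-products
  to products and transposes to adjoints (\<open>fourier_slice_t_prod\<close>, \<open>fourier_slice_t_transpose\<close>).
  Orthogonal tensors therefore have unitary slices, the \<open>k\<close>th slices of \<open>A\<close> and \<open>B\<close> are unitarily
  equivalent and have the same singular values (\<open>singular_values_unitary_equiv\<close>).  The Kilmer-Martin tensor, and with it the
  T-singular values, depends on these numbers only.
\<close>

section \<open>Block circulant matrices\<close>

lemma block_index_less:
  assumes "a < p" "i < (m::nat)"
  shows "a * m + i < m * p"
proof -
  have "a * m + i < Suc a * m" using assms by simp
  also have "\<dots> \<le> m * p" using assms by (metis Suc_leI mult.commute mult_le_mono2)
  finally show ?thesis .
qed

lemma block_index_cases: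
  assumes "x < m * (p::nat)"
  obtains a i where "a < p" "i < m" "x = a * m + i"
proof
  have "m > 0" using assms by (cases m) auto
  thus "x mod m < m" by simp
  show "x div m < p" using assms by (simp add: less_mult_imp_div_less mult.commute)
  show "x = x div m * m + x mod m" by simp
qed

lemma block_index_eq_iff:
  assumes "i < (m::nat)" "j < m"
  shows "a * m + i = b * m + j \<longleftrightarrow> a = b \<and> i = j"
proof
  assume eq: "a * m + i = b * m + j"
  have "(a * m + i) div m = a" "(b * m + j) div m = b" using assms by simp_all
  thus "a = b \<and> i = j" using eq by simp
qed simp

lemma sum_blocks:
  "sum f {..<s * p} = (\<Sum>t<p. \<Sum>q<s. f (t * s + q))" for s p :: nat
proof -
  have "sum f {..<s * p} = (\<Sum>t<p. sum f {t * s..<t * s + s})"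
    by (simp add: sum.nat_group mult.commute)
  also have "\<dots> = (\<Sum>t<p. \<Sum>q<s. f (t * s + q))"
  proof (rule sum.cong[OF refl])
    show "sum f {t * s..<t * s + s} = (\<Sum>q<s. f (t * s + q))" for t
      by (rule sum.reindex_bij_witness[of _ "\<lambda>q. t * s + q" "\<lambda>x. x - t * s"]) auto
  qed
  finally show ?thesis .
qed

lemma mult_mat_index:
  assumes "M \<in> carrier_mat r c" "N \<in> carrier_mat c d" "x < r" "y < d"
  shows "(M * N) $$ (x, y) = (\<Sum>z<c. M $$ (x, z) * N $$ (z, y))"
  using assms by (simp add: scalar_prod_def atLeast0LessThan)

lemma mult_mat_block_index:
  assumes "M \<in> carrier_mat r (s * p)" "N \<in> carrier_mat (s * p) d" "x < r" "y < d"
  shows "(M * N) $$ (x, y) = (\<Sum>t<p. \<Sum>q<s. M $$ (x, t * s + q) * N $$ (t * s + q, y))"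
  by (simp only: mult_mat_index[OF assms] sum_blocks)

lemma bcirc_carrier [simp]: "bcirc m n p A \<in> carrier_mat (m * p) (n * p)"
  and bcirc_dims [simp]: "dim_row (bcirc m n p A) = m * p" "dim_col (bcirc m n p A) = n * p"
  by (simp_all add: bcirc_def)

lemma bcirc_index:
  assumes "a < p" "b < p" "i < m" "j < n"
  shows "bcirc m n p A $$ (a * m + i, b * n + j) = A ! ((a + p - b) mod p) $$ (i, j)"
  using assms block_index_less[of a p i m] block_index_less[of b p j n] by (simp add: bcirc_def)

text \<open>Invariance under the simultaneous cyclic shift of block rows and block columns.  The point of
  this form is that it visibly passes to products, transposes and the identity.\<close>

definition block_circulant :: "nat \<Rightarrow> nat \<Rightarrow> nat \<Rightarrow> real mat \<Rightarrow> bool" where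
  "block_circulant m n p M \<longleftrightarrow> M \<in> carrier_mat (m * p) (n * p) \<and>
     (\<forall>a<p. \<forall>b<p. \<forall>i<m. \<forall>j<n.
        M $$ (Suc a mod p * m + i, Suc b mod p * n + j) = M $$ (a * m + i, b * n + j))"

lemma block_circulantD:
  assumes "block_circulant m n p M" "a < p" "b < p" "i < m" "j < n"
  shows "M $$ (Suc a mod p * m + i, Suc b mod p * n + j) = M $$ (a * m + i, b * n + j)"
  using assms by (simp add: block_circulant_def)

lemma cyclic_diff_Suc:
  assumes "a < p" "b < (p::nat)"
  shows "(Suc a mod p + p - Suc b mod p) mod p = (a + p - b) mod p"
proof -
  consider "Suc a = p" "Suc b = p" | "Suc a = p" "Suc b < p" | "Suc a < p" "Suc b = p"
    | "Suc a < p" "Suc b < p"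
    using assms by linarith
  thus ?thesis
  proof cases
    case 2
    hence "a + p - b = (p - Suc b) + p" by linarith
    hence "(a + p - b) mod p = (p - Suc b) mod p" by (simp only: mod_add_self2)
    thus ?thesis using 2 by simp
  next
    case 3
    hence "a + p - b = Suc a" by linarith
    moreover have "(Suc a + p) mod p = Suc a mod p" by (rule mod_add_self2)
    ultimately show ?thesis using 3 by simp
  qed auto
qed

lemma block_circulant_bcirc: "block_circulant m n p (bcirc m n p A)"
  unfolding block_circulant_def
proof (intro conjI allI impI)
  fix a b i j assume *: "a < p" "b < p" "i < m" "j < n"
  hence "Suc a mod p < p" "Suc b mod p < p" by simp_all
  thus "bcirc m n p A $$ (Suc a mod p * m + i, Suc b mod p * n + j) =
      bcirc m n p A $$ (a * m + i, b * n + j)"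
    using * by (simp only: bcirc_index cyclic_diff_Suc)
qed simp

text \<open>Conversely, the first block column of a block circulant matrix lists the slices of a tensor
  that it comes from: shifting back \<open>b\<close> times moves any block into that column.\<close>

lemma block_circulant_imp_bcirc:
  assumes "p > 0" "block_circulant m n p M"
  shows "M \<in> bcirc m n p ` tensors m n p"
proof
  define A where "A = map (\<lambda>k. mat m n (\<lambda>(i, j). M $$ (k * m + i, j))) [0..<p]"
  show "A \<in> tensors m n p" by (auto simp: A_def tensors_def)
  have *: "M $$ (a * m + i, b * n + j) = M $$ ((a + p - b) mod p * m + i, j)"
    if "a < p" "b < p" "i < m" "j < n" for a b i j
    using that
  proof (induction b arbitrary: a)
    case (Suc b)
    \<comment> \<open>the cyclic predecessor of \<open>a\<close>\<close>
    define a' where "a' = (a + p - 1) mod p"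
    have a': "a' < p" "Suc a' mod p = a"
      using Suc.prems(1) by (cases a; simp add: a'_def)+
    have shift: "(a' + p - b) mod p = (a + p - Suc b) mod p"
      using cyclic_diff_Suc[OF a'(1), of b] a'(2) Suc.prems(2) by simp
    have "M $$ (a * m + i, Suc b * n + j) = M $$ (a' * m + i, b * n + j)"
      using block_circulantD[OF assms(2) a'(1), of b i j] a'(2) Suc.prems by simp
    also have "\<dots> = M $$ ((a + p - Suc b) mod p * m + i, j)"
      using Suc.IH[OF a'(1)] Suc.prems shift by simp
    finally show ?case .
  qed simp
  show "M = bcirc m n p A"
  proof (rule eq_matI)
    fix x y assume "x < dim_row (bcirc m n p A)" "y < dim_col (bcirc m n p A)"
    then obtain a i b j where "a < p" "i < m" "x = a * m + i" "b < p" "j < n" "y = b * n + j"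
      by (metis bcirc_dims block_index_cases)
    thus "M $$ (x, y) = bcirc m n p A $$ (x, y)"
      using * assms(1) by (simp add: bcirc_index A_def)
  qed (use assms in \<open>auto simp: block_circulant_def\<close>)
qed

lemma bcirc_inv_block_circulant:
  assumes "p > 0" "block_circulant m n p M"
  shows "bcirc_inv m n p M \<in> tensors m n p" "bcirc m n p (bcirc_inv m n p M) = M"
  unfolding bcirc_inv_def
  using block_circulant_imp_bcirc[OF assms] by (auto intro: inv_into_into f_inv_into_f)

text \<open>Shifting the outer indices of a product of blocks is undone by shifting the summation index
  cyclically along with them.\<close>

lemma block_circulant_mult:
  assumes "block_circulant m s p M" "block_circulant s n p N"
  shows "block_circulant m n p (M * N)"
  unfolding block_circulant_def
proof (intro conjI allI impI)
  have MN: "M \<in> carrier_mat (m * p) (s * p)" "N \<in> carrier_mat (s * p) (n * p)"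
    using assms by (auto simp: block_circulant_def)
  thus "M * N \<in> carrier_mat (m * p) (n * p)" by simp
  fix a b i j assume *: "a < p" "b < p" "i < m" "j < n"
  let ?x = "Suc a mod p * m + i" and ?y = "Suc b mod p * n + j"
  have lt: "?x < m * p" "?y < n * p" "a * m + i < m * p" "b * n + j < n * p"
    using * by (auto intro!: block_index_less)
  have "(M * N) $$ (?x, ?y) = (\<Sum>t<p. \<Sum>q<s. M $$ (?x, t * s + q) * N $$ (t * s + q, ?y))"
    by (rule mult_mat_block_index[OF MN lt(1,2)])
  also have "\<dots> = (\<Sum>t<p. \<Sum>q<s. M $$ (?x, Suc t mod p * s + q) * N $$ (Suc t mod p * s + q, ?y))"
  proof (rule sum.reindex_bij_witness[of _ "\<lambda>t. Suc t mod p" "\<lambda>t. (t + p - 1) mod p"])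
    fix t assume t: "t \<in> {..<p}"
    show pred: "Suc ((t + p - 1) mod p) mod p = t" using t by (cases t) auto
    show "(Suc t mod p + p - 1) mod p = t" using t by (cases "Suc t = p") auto
    show "(\<Sum>q<s. M $$ (?x, Suc ((t + p - 1) mod p) mod p * s + q)
            * N $$ (Suc ((t + p - 1) mod p) mod p * s + q, ?y)) =
          (\<Sum>q<s. M $$ (?x, t * s + q) * N $$ (t * s + q, ?y))"
      by (simp only: pred)
    show "(t + p - 1) mod p \<in> {..<p}" "Suc t mod p \<in> {..<p}" using t by auto
  qed
  also have "\<dots> = (\<Sum>t<p. \<Sum>q<s. M $$ (a * m + i, t * s + q) * N $$ (t * s + q, b * n + j))"
  proof (intro sum.cong refl)
    fix t q assume "t \<in> {..<p}" "q \<in> {..<s}"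
    thus "M $$ (?x, Suc t mod p * s + q) * N $$ (Suc t mod p * s + q, ?y) =
        M $$ (a * m + i, t * s + q) * N $$ (t * s + q, b * n + j)"
      using * by (simp only: lessThan_iff block_circulantD[OF assms(1)] block_circulantD[OF assms(2)])
  qed
  also have "\<dots> = (M * N) $$ (a * m + i, b * n + j)"
    by (rule mult_mat_block_index[OF MN lt(3,4), symmetric])
  finally show "(M * N) $$ (?x, ?y) = (M * N) $$ (a * m + i, b * n + j)" .
qed

lemma block_circulant_transpose:
  assumes "block_circulant m n p M"
  shows "block_circulant n m p (transpose_mat M)"
proof -
  have M: "M \<in> carrier_mat (m * p) (n * p)" using assms by (simp add: block_circulant_def)
  have "transpose_mat M $$ (a * n + i, b * m + j) = M $$ (b * m + j, a * n + i)"
    if "a < p" "b < p" "i < n" "j < m" for a b i j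
    using M that by (auto simp: block_index_less)
  thus ?thesis using M assms by (auto simp: block_circulant_def)
qed

lemma block_circulant_one: "block_circulant n n p (1\<^sub>m (n * p))"
proof -
  have "Suc a mod p = Suc b mod p \<longleftrightarrow> a = b" if "a < p" "b < p" for a b
    using that by (cases "Suc a = p"; cases "Suc b = p") auto
  thus ?thesis by (auto simp: block_circulant_def block_index_less block_index_eq_iff)
qed

section \<open>The algebra of tensors under the T-product\<close>

context
  fixes p :: nat
  assumes p: "p > 0"
begin

lemma t_prod_closed: "t_prod m s n p A B \<in> tensors m n p"
  and bcirc_t_prod: "bcirc m n p (t_prod m s n p A B) = bcirc m s p A * bcirc s n p B"
  unfolding t_prod_def
  by (rule bcirc_inv_block_circulant[OF p block_circulant_mult[OF block_circulant_bcirc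
    block_circulant_bcirc]])+

lemma bcirc_t_transpose: "bcirc n m p (t_transpose m n p A) = transpose_mat (bcirc m n p A)"
  unfolding t_transpose_def
  by (rule bcirc_inv_block_circulant[OF p block_circulant_transpose[OF block_circulant_bcirc]])

lemma bcirc_t_id: "bcirc n n p (t_id n p) = 1\<^sub>m (n * p)"
  unfolding t_id_def
  by (rule bcirc_inv_block_circulant[OF p block_circulant_one])

end

lemma tensor_eqI:
  assumes "p > 0" "A \<in> tensors m n p" "B \<in> tensors m n p" "bcirc m n p A = bcirc m n p B"
  shows "A = B"
  using bcirc_inj_on[OF assms(1)] assms(2-) by (meson inj_onD)

lemma t_prod_assoc:
  assumes "p > 0"
  shows "t_prod m r n p (t_prod m s r p A B) C = t_prod m s n p A (t_prod s r n p B C)"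
  by (rule tensor_eqI[of _ _ m n, OF assms]) (auto simp: assms t_prod_closed bcirc_t_prod
    intro!: assoc_mult_mat[of _ "m * p" "s * p" _ "r * p" _ "n * p"])

lemma t_prod_id_left:
  assumes "p > 0" "A \<in> tensors m n p"
  shows "t_prod m m n p (t_id m p) A = A"
  by (rule tensor_eqI[of _ _ m n, OF assms(1)]) (auto simp: assms t_prod_closed bcirc_t_prod bcirc_t_id)

lemma t_prod_id_right:
  assumes "p > 0" "A \<in> tensors m n p"
  shows "t_prod m n n p A (t_id n p) = A"
  by (rule tensor_eqI[of _ _ m n, OF assms(1)]) (auto simp: assms t_prod_closed bcirc_t_prod bcirc_t_id)

section \<open>Tubal rank\<close>

text \<open>The inner dimension \<open>r\<close> survives multiplication by square tensors on either side:
  absorb \<open>U\<close> into the left and \<open>V\<close> into the right factor.\<close>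

lemma tubal_factorization_transport:
  assumes "p > 0" "A = t_prod m n n p (t_prod m m n p U B) V"
    and "\<exists>C \<in> tensors m r p. \<exists>D \<in> tensors r n p. B = t_prod m r n p C D"
  shows "\<exists>C \<in> tensors m r p. \<exists>D \<in> tensors r n p. A = t_prod m r n p C D"
proof -
  obtain C D where "B = t_prod m r n p C D" using assms(3) by blast
  hence "A = t_prod m r n p (t_prod m m r p U C) (t_prod r n n p D V)"
    by (simp add: assms(1,2) t_prod_assoc)
  thus ?thesis using t_prod_closed[OF assms(1)] by blast
qed

lemma tubal_rank_cong:
  assumes "p > 0"
    and "A = t_prod m n n p (t_prod m m n p U B) V"
    and "B = t_prod m n n p (t_prod m m n p U' A) V'"
  shows "tubal_rank m n p A = tubal_rank m n p B"
proof -
  have "(\<exists>C \<in> tensors m r p. \<exists>D \<in> tensors r n p. A = t_prod m r n p C D) \<longleftrightarrow>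
        (\<exists>C \<in> tensors m r p. \<exists>D \<in> tensors r n p. B = t_prod m r n p C D)" for r
    using tubal_factorization_transport[OF assms(1,2)] tubal_factorization_transport[OF assms(1,3)]
    by blast
  thus ?thesis by (simp add: tubal_rank_def)
qed

lemma t_orth_equiv_inverse:
  assumes "p > 0" "B \<in> tensors m n p" "t_orthogonal m p Y" "t_orthogonal n p Z"
    and A: "A = t_prod m n n p (t_prod m m n p Y B) (t_transpose n n p Z)"
  shows "B = t_prod m n n p (t_prod m m n p (t_transpose m m p Y) A) Z"
proof -
  let ?Y' = "t_transpose m m p Y" and ?Z' = "t_transpose n n p Z"
  have "t_prod m n n p (t_prod m m n p ?Y' A) Z =
      t_prod m n n p (t_prod m m n p (t_prod m m m p ?Y' Y) B) (t_prod n n n p ?Z' Z)"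
    by (simp only: A t_prod_assoc[OF assms(1)])
  also have "\<dots> = B"
    using assms by (simp add: t_orthogonal_def t_prod_id_left t_prod_id_right)
  finally show ?thesis by simp
qed

section \<open>Singular values under unitary equivalence\<close>

lemma mat_adjoint_dims [simp]:
  "dim_row (mat_adjoint M) = dim_col M" "dim_col (mat_adjoint M) = dim_row M"
  by (simp_all add: mat_adjoint_def)

lemma mat_adjoint_carrier:
  "M \<in> carrier_mat r c \<Longrightarrow> mat_adjoint M \<in> carrier_mat c r"
  by (rule carrier_matI) simp_all

lemma mat_adjoint_index:
  fixes M :: "complex mat"
  assumes "i < dim_col M" "j < dim_row M"
  shows "mat_adjoint M $$ (i, j) = cnj (M $$ (j, i))"
  using assms by (simp add: mat_adjoint_def mat_of_rows_def)

lemma mat_adjoint_mult: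
  fixes M N :: "complex mat"
  assumes "M \<in> carrier_mat r s" "N \<in> carrier_mat s c"
  shows "mat_adjoint (M * N) = mat_adjoint N * mat_adjoint M"
  by (rule eq_matI)
    (use assms in \<open>auto simp: mat_adjoint_index scalar_prod_def mult.commute intro!: sum.cong\<close>)

lemma mult_mat_assoc:
  fixes A B C :: "'a :: semiring_0 mat"
  assumes "dim_col A = dim_row B" "dim_col B = dim_row C"
  shows "A * B * C = A * (B * C)"
  by (rule assoc_mult_mat) (use assms in auto)

text \<open>For \<open>N = U M W\<close> with \<open>U\<^sup>* U = 1\<close>, the Gram matrix of \<open>N\<close> is \<open>W\<^sup>* (M\<^sup>* M) W\<close>, which is
  similar to \<open>M\<^sup>* M\<close> because \<open>W\<close> is unitary.\<close>

lemma singular_values_unitary_equiv: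
  fixes M U W :: "complex mat"
  assumes M: "M \<in> carrier_mat m n" and U: "U \<in> carrier_mat m m" and W: "W \<in> carrier_mat n n"
    and UU: "mat_adjoint U * U = 1\<^sub>m m"
    and WW: "mat_adjoint W * W = 1\<^sub>m n" "W * mat_adjoint W = 1\<^sub>m n"
  shows "singular_values (U * M * W) = singular_values M"
proof -
  have dims: "dim_row M = m" "dim_col M = n" "dim_row U = m" "dim_col U = m"
    "dim_row W = n" "dim_col W = n"
    using M U W by auto
  have "U * M \<in> carrier_mat m n" using U M by simp
  hence adjoint: "mat_adjoint (U * M * W) = mat_adjoint W * (mat_adjoint M * mat_adjoint U)"
    using W by (simp only: mat_adjoint_mult[of _ m n _ n] mat_adjoint_mult[OF U M])
  have "mat_adjoint (U * M * W) * (U * M * W) =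
      mat_adjoint W * (mat_adjoint M * (mat_adjoint U * U) * M) * W"
    unfolding adjoint by (simp only: mult_mat_assoc dims mat_adjoint_dims index_mult_mat)
  also have "\<dots> = mat_adjoint W * (mat_adjoint M * M) * W"
    by (simp only: UU right_mult_one_mat[OF mat_adjoint_carrier[OF M]])
  finally have gram: "mat_adjoint (U * M * W) * (U * M * W) =
    mat_adjoint W * (mat_adjoint M * M) * W" .
  have "similar_mat (mat_adjoint (U * M * W) * (U * M * W)) (mat_adjoint M * M)"
  proof (rule similar_matI[OF _ WW gram])
    show "{mat_adjoint (U * M * W) * (U * M * W), mat_adjoint M * M, mat_adjoint W, W}
        \<subseteq> carrier_mat n n"
      by (simp only: insert_subset empty_subsetI carrier_mat_def mem_Collect_eq index_mult_mat
        mat_adjoint_dims dims simp_thms)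
  qed
  hence "char_poly (mat_adjoint (U * M * W) * (U * M * W)) = char_poly (mat_adjoint M * M)"
    by (rule char_poly_similar)
  thus ?thesis by (simp only: singular_values_def index_mult_mat dims)
qed

section \<open>The Fourier transform of the T-product\<close>

lemma fourier_slice_carrier [simp]: "fourier_slice m n p A k \<in> carrier_mat m n"
  and fourier_slice_dims [simp]:
    "dim_row (fourier_slice m n p A k) = m" "dim_col (fourier_slice m n p A k) = n"
  by (simp_all add: fourier_slice_def)

lemma omega_power_cong:
  assumes "p > 0" "x mod p = y mod p"
  shows "omega p ^ (k * x) = omega p ^ (k * y)"
proof -
  have *: "omega p ^ (k * z) = omega p ^ (k * (z mod p))" for z
  proof -
    have "omega p ^ (k * z) = omega p ^ (p * (k * (z div p)) + k * (z mod p))"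
      by (metis distrib_left mult.left_commute mult_div_mod_eq)
    also have "\<dots> = omega p ^ (k * (z mod p))"
      using assms(1) by (simp add: power_add power_mult omega_power_self)
    finally show ?thesis .
  qed
  show ?thesis using *[of x] *[of y] assms(2) by simp
qed

text \<open>The discrete Fourier vectors are joint eigenvectors of all cyclic shifts: transforming any
  block column of \<open>bcirc A\<close> gives the transform of the first one, which is the Fourier slice, times
  a phase.\<close>

lemma fourier_block_column:
  assumes "p > 0" "b < p" "i < m" "j < n"
  shows "(\<Sum>l<p. omega p ^ (k * l) * complex_of_real (bcirc m n p A $$ (l * m + i, b * n + j))) =
    fourier_slice m n p A k $$ (i, j) * omega p ^ (k * b)"
proof -
  have inv: "((l + p - b) mod p + b) mod p = l" "((l + b) mod p + p - b) mod p = l" if "l < p" for l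
  proof -
    have "((l + p - b) mod p + b) mod p = (l + p - b + b) mod p" by (simp add: mod_add_left_eq)
    thus "((l + p - b) mod p + b) mod p = l" using that assms(2) by simp
    have "((l + b) mod p + p - b) mod p = ((l + b) mod p + (p - b)) mod p"
      using assms(2) by simp
    also have "\<dots> = (l + b + (p - b)) mod p" by (simp only: mod_add_left_eq)
    finally show "((l + b) mod p + p - b) mod p = l" using that assms(2) by simp
  qed
  have "(\<Sum>l<p. omega p ^ (k * l) * complex_of_real (bcirc m n p A $$ (l * m + i, b * n + j))) =
      (\<Sum>l<p. omega p ^ (k * (l + b)) * complex_of_real (A ! l $$ (i, j)))"
  proof (rule sum.reindex_bij_witness[of _ "\<lambda>l. (l + b) mod p" "\<lambda>l. (l + p - b) mod p"])
    fix l assume l: "l \<in> {..<p}"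
    have "omega p ^ (k * ((l + p - b) mod p + b)) = omega p ^ (k * l)"
      using l inv assms(1) by (intro omega_power_cong) auto
    thus "omega p ^ (k * ((l + p - b) mod p + b)) *
        complex_of_real (A ! ((l + p - b) mod p) $$ (i, j)) =
      omega p ^ (k * l) * complex_of_real (bcirc m n p A $$ (l * m + i, b * n + j))"
      using l assms by (simp add: bcirc_index)
  qed (use inv assms(1) in auto)
  also have "\<dots> = fourier_slice m n p A k $$ (i, j) * omega p ^ (k * b)"
    using assms
    by (auto simp: fourier_slice_def sum_distrib_right distrib_left power_add intro!: sum.cong)
  finally show ?thesis .
qed

lemma fourier_slice_eq_first_column:
  assumes "p > 0" "i < m" "j < n"
  shows "fourier_slice m n p A k $$ (i, j) =
    (\<Sum>l<p. omega p ^ (k * l) * complex_of_real (bcirc m n p A $$ (l * m + i, j)))"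
  using fourier_block_column[OF assms(1,1,2,3), of k A] by simp

text \<open>Transform the first block column of \<open>bcirc A * bcirc B\<close>.  Summing over the rows of \<open>bcirc A\<close>
  first leaves the Fourier slice of \<open>A\<close> times the phases that transform \<open>B\<close>.\<close>

lemma fourier_slice_t_prod:
  assumes p: "p > 0"
  shows "fourier_slice m n p (t_prod m s n p A B) k =
    fourier_slice m s p A k * fourier_slice s n p B k"
proof (rule eq_matI)
  fix i j assume "i < dim_row (fourier_slice m s p A k * fourier_slice s n p B k)"
    and "j < dim_col (fourier_slice m s p A k * fourier_slice s n p B k)"
  hence ij: "i < m" "j < n" by simp_all
  let ?M = "bcirc m s p A" and ?N = "bcirc s n p B"
  let ?w = "\<lambda>l. omega p ^ (k * l)"
  have "n \<le> n * p" using p by simp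
  hence jn: "j < n * p" using ij by linarith
  have "fourier_slice m n p (t_prod m s n p A B) k $$ (i, j) =
      (\<Sum>l<p. ?w l * complex_of_real ((?M * ?N) $$ (l * m + i, j)))"
    by (simp only: fourier_slice_eq_first_column[OF p ij] bcirc_t_prod[OF p])
  also have "\<dots> = (\<Sum>l<p. \<Sum>t<p. \<Sum>q<s. ?w l * complex_of_real (?M $$ (l * m + i, t * s + q)) *
      complex_of_real (?N $$ (t * s + q, j)))"
  proof (rule sum.cong[OF refl])
    fix l assume "l \<in> {..<p}"
    hence "l * m + i < m * p" using ij by (auto intro: block_index_less)
    hence "(?M * ?N) $$ (l * m + i, j) =
        (\<Sum>t<p. \<Sum>q<s. ?M $$ (l * m + i, t * s + q) * ?N $$ (t * s + q, j))"
      using jn by (intro mult_mat_block_index) auto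
    thus "?w l * complex_of_real ((?M * ?N) $$ (l * m + i, j)) =
        (\<Sum>t<p. \<Sum>q<s. ?w l * complex_of_real (?M $$ (l * m + i, t * s + q)) *
          complex_of_real (?N $$ (t * s + q, j)))"
      by (simp only: of_real_sum of_real_mult sum_distrib_left mult.assoc)
  qed
  also have "\<dots> = (\<Sum>t<p. \<Sum>q<s. (\<Sum>l<p. ?w l * complex_of_real (?M $$ (l * m + i, t * s + q))) *
      complex_of_real (?N $$ (t * s + q, j)))"
    unfolding sum_distrib_right
    by (subst sum.swap) (auto intro!: sum.cong sum.swap)
  also have "\<dots> = (\<Sum>t<p. \<Sum>q<s. fourier_slice m s p A k $$ (i, q) *
      (?w t * complex_of_real (?N $$ (t * s + q, j))))"
    using p ij by (auto intro!: sum.cong simp: fourier_block_column mult.assoc)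
  also have "\<dots> = (\<Sum>q<s. fourier_slice m s p A k $$ (i, q) * fourier_slice s n p B k $$ (q, j))"
    using p ij by (subst sum.swap)
      (auto intro!: sum.cong simp: fourier_slice_eq_first_column sum_distrib_left)
  also have "\<dots> = (fourier_slice m s p A k * fourier_slice s n p B k) $$ (i, j)"
    using ij by (intro mult_mat_index[symmetric]) auto
  finally show "fourier_slice m n p (t_prod m s n p A B) k $$ (i, j) =
    (fourier_slice m s p A k * fourier_slice s n p B k) $$ (i, j)" .
qed simp_all

text \<open>Transposing \<open>bcirc A\<close> transposes the slices and reverses their cyclic order; since \<open>A\<close> is real
  and \<open>cnj (omega p ^ l) = omega p ^ (p - l)\<close>, the reversal amounts to complex conjugation.\<close>

lemma fourier_slice_t_transpose:
  assumes p: "p > 0"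
  shows "fourier_slice n m p (t_transpose m n p A) k = mat_adjoint (fourier_slice m n p A k)"
proof (rule eq_matI)
  fix i j assume "i < dim_row (mat_adjoint (fourier_slice m n p A k))"
    and "j < dim_col (mat_adjoint (fourier_slice m n p A k))"
  hence ij: "i < n" "j < m" by simp_all
  have "m \<le> m * p" using p by simp
  hence jm: "j < m * p" using ij by linarith
  have h: "(p - (p - l) mod p) mod p = l" if "l < p" for l
    using that by (cases "l = 0") simp_all
  have "fourier_slice n m p (t_transpose m n p A) k $$ (i, j) =
      (\<Sum>l<p. omega p ^ (k * l) * complex_of_real (bcirc m n p A $$ (0 * m + j, l * n + i)))"
    unfolding fourier_slice_eq_first_column[OF p ij] bcirc_t_transpose[OF p]
    using ij jm by (auto intro!: sum.cong simp: block_index_less)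
  also have "\<dots> = (\<Sum>l<p. omega p ^ (k * l) * complex_of_real (A ! ((p - l) mod p) $$ (j, i)))"
    using p ij by (intro sum.cong refl) (simp only: lessThan_iff bcirc_index add_0_left)
  also have "\<dots> = (\<Sum>l<p. cnj (omega p) ^ (k * l) * complex_of_real (A ! l $$ (j, i)))"
    by (rule sum.reindex_bij_witness[of _ "\<lambda>l. (p - l) mod p" "\<lambda>l. (p - l) mod p"])
      (use p h in \<open>auto simp: cnj_omega_power\<close>)
  also have "\<dots> = mat_adjoint (fourier_slice m n p A k) $$ (i, j)"
    using ij by (simp add: mat_adjoint_index) (simp add: fourier_slice_def)
  finally show "fourier_slice n m p (t_transpose m n p A) k $$ (i, j) =
    mat_adjoint (fourier_slice m n p A k) $$ (i, j)" .
qed simp_all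

lemma fourier_slice_t_id:
  assumes p: "p > 0"
  shows "fourier_slice n n p (t_id n p) k = 1\<^sub>m n"
proof (rule eq_matI)
  fix i j assume "i < dim_row (1\<^sub>m n :: complex mat)" "j < dim_col (1\<^sub>m n :: complex mat)"
  hence ij: "i < n" "j < n" by simp_all
  have "n \<le> n * p" using p by simp
  hence jn: "j < n * p" using ij by linarith
  have "l * n + i = j \<longleftrightarrow> l = 0 \<and> i = j" for l
    using block_index_eq_iff[OF ij, of l 0] by simp
  hence "fourier_slice n n p (t_id n p) k $$ (i, j) =
      (\<Sum>l<p. if l = 0 then (if i = j then 1 else 0) else 0)"
    unfolding fourier_slice_eq_first_column[OF p ij] bcirc_t_id[OF p]
    using ij jn by (intro sum.cong) (auto simp: block_index_less)
  thus "fourier_slice n n p (t_id n p) k $$ (i, j) = 1\<^sub>m n $$ (i, j)"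
    using p ij by (simp add: sum.delta)
qed simp_all

lemma fourier_slice_orthogonal:
  fixes k :: nat
  assumes "p > 0" "t_orthogonal n p Q"
  defines "U \<equiv> fourier_slice n n p Q k"
  shows "mat_adjoint U * U = 1\<^sub>m n" "U * mat_adjoint U = 1\<^sub>m n"
  using assms(2) unfolding U_def t_orthogonal_def
  by (metis assms(1) fourier_slice_t_id fourier_slice_t_prod fourier_slice_t_transpose)+

section \<open>T-singular values\<close>

lemma t_singular_values_cong:
  assumes "\<And>k. singular_values (fourier_slice m n p A k) = singular_values (fourier_slice m n p B k)"
  shows "t_singular_values m n p A = t_singular_values m n p B"
proof -
  have "km_entry m n p A i k = km_entry m n p B i k" for i k
    by (simp add: km_entry_def assms)
  hence "km_tensor m n p A = km_tensor m n p B"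
    by (simp only: km_tensor_def)
  thus ?thesis by (simp only: t_singular_values_def t_singular_value_def[abs_def])
qed

theorem corollary3p3:
  fixes m n p :: nat and A B :: "real mat list"
  assumes "m \<ge> 1" and "n \<ge> 1" and "p \<ge> 1"
    and "A \<in> tensors m n p" and "B \<in> tensors m n p"
    and "t_orth_equiv m n p A B"
  shows "tubal_rank m n p A = tubal_rank m n p B \<and>
         t_singular_values m n p A = t_singular_values m n p B"
proof
  have p: "p > 0" using assms(3) by simp
  obtain Y Z where Y: "t_orthogonal m p Y" and Z: "t_orthogonal n p Z"
    and A: "A = t_prod m n n p (t_prod m m n p Y B) (t_transpose n n p Z)"
    using assms(6) by (auto simp: t_orth_equiv_def)
  show "tubal_rank m n p A = tubal_rank m n p B"
    by (rule tubal_rank_cong[OF p A t_orth_equiv_inverse[OF p assms(5) Y Z A]])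
  show "t_singular_values m n p A = t_singular_values m n p B"
  proof (rule t_singular_values_cong)
    fix k
    let ?U = "fourier_slice m m p Y k" and ?V = "fourier_slice n n p Z k"
    have "mat_adjoint (mat_adjoint ?V) = ?V"
      by (rule eq_matI) (simp_all add: mat_adjoint_index)
    thus "singular_values (fourier_slice m n p A k) = singular_values (fourier_slice m n p B k)"
      unfolding A fourier_slice_t_prod[OF p] fourier_slice_t_transpose[OF p]
      by (intro singular_values_unitary_equiv)
        (simp_all add: fourier_slice_orthogonal[OF p Y] fourier_slice_orthogonal[OF p Z]
          mat_adjoint_carrier)
  qed
qed

end
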